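(* Let $T\in\mathfrak{L}$, written as $T=\sum_{i=0}^{\infty}q_i(x)D^i$ with $q_i\in\mathbb{R}[x]$, $i\in\mathbb{N}_0$. The following assertions are equivalent: (1) $T\in\mathfrak{L}(SOS)$; (2) $T_y\in\mathfrak{L}(SOS)$ for all $y\in\mathbb{R}$; (3) $\langle p_{y,2m},f\rangle\ge 0$ for all $y\in\mathbb{R}$, $m\in\mathbb{N}_0$, $f\in SOS_{2m}$, i.e., $p_{y,2m}\in SOS_{2m}^*$; (4) $\mathcal{H}_{y,m}$ is positive semidefinite for all $y\in\mathbb{R}$, $m\in\mathbb{N}_0$; (5) For any $s\in\mathbb{R}$ there exists $\mu_s\in\mathfrak{M}_1^+$ such that, for every $i\in\mathbb{N}_0$, $\int t^i\,d\mu_s(t)$ is a polynomial in $s$ with real coefficients, and $i!\,q_i(y)=\int t^i\,d\mu_y(t)$ for all $y\in\mathbb{R}$, $i\in\mathbb{N}_0$. The family of operators $\{T_y\}_{y\in\mathbb{R}}$ is then given by the convolutions $$T_y(f)(x)=\int f(t+x)\,d\mu_y(t),\quad f\in\mathbb{R}[x],\ y\in\mathbb{R}.$$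
   Context: $\mathbb{N}_0$ is the set of non-negative integers; $\mathbb{R}_d[x]=\{p\in\mathbb{R}[x]:\deg p\le d\}$; $D=\frac{d}{dx}$. $SOS=\{\sum_{i=1}^r p_i(x)^2: p_i\in\mathbb{R}[x],\ 1\le i\le r<\infty\}$ (equivalently, the set of $p\in\mathbb{R}[x]$ with $p(x)\ge 0$ for all $x\in\mathbb{R}$), and $SOS_d=SOS\cap\mathbb{R}_d[x]$. $\mathfrak{L}$ is the set of all linear operators $T:\mathbb{R}[x]\to\mathbb{R}[x]$, and $\mathfrak{L}(V)=\{T\in\mathfrak{L}:T(V)\subseteq V\}$. Any $T\in\mathfrak{L}$ is uniquely represented as a formal power series $T=\sum_{i=0}^\infty q_i(x)D^i$ with $q_i\in\mathbb{R}[x]$ (applied to a polynomial, only finitely many terms are nonzero). For $y\in\mathbb{R}$ and $m\in\mathbb{N}_0$ define $$T_y=\sum_{i=0}^\infty q_i(y)D^i\in\mathfrak{L},\qquad p_{y,m}(x)=\sum_{i=0}^m q_i(y)x^i\in\mathbb{R}[x],\qquad \mathcal{H}_{y,m}=\big((i+j)!\,q_{i+j}(y)\big)_{i,j=0}^m,$$ the last being an $(m+1)\times(m+1)$ Hankel matrix. The inner product on $\mathbb{R}[x]$ is the Fischer-Fock one: $\langle \sum_k a_kx^k,\sum_k b_kx^k\rangle=\sum_k k!\,a_kb_k$. For a cone $K\subseteq\mathbb{R}[x]$, $K^*=\{f\in\mathbb{R}[x]:\langle f,g\rangle\ge 0 \text{ for all } g\in K\}$. $\mathfrak{M}_1^+$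 is the class of non-negative measures $\mu$ on $\mathbb{R}$ with all moments finite, i.e. $\int|t^m|\,d\mu(t)<\infty$ for all $m\in\mathbb{N}_0$. A real symmetric $k\times k$ matrix $A$ is positive semidefinite if $\mathbf{x}^tA\mathbf{x}\ge0$ for all $\mathbf{x}\in\mathbb{R}^k$. *)

theory Defs
  imports
    "Jordan_Normal_Form.Matrix"
    "HOL-Analysis.Analysis"
    "HOL-Computational_Algebra.Polynomial"
begin

definition SOS :: "real poly set" where
  "SOS = {f. \<exists>(r::nat) (p :: nat \<Rightarrow> real poly). 1 \<le> r \<and> f = (\<Sum>i=1..r. (p i)\<^sup>2)}"

definition polys_upto :: "nat \<Rightarrow> real poly set" where
  "polys_upto d = {p. degree p \<le> d}"

definition SOS_upto :: "nat \<Rightarrow> real poly set" where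
  "SOS_upto d = SOS \<inter> polys_upto d"

definition lin_ops :: "(real poly \<Rightarrow> real poly) set" where
  "lin_ops = {T. Vector_Spaces.linear Polynomial.smult Polynomial.smult T}"

definition preservers :: "real poly set \<Rightarrow> (real poly \<Rightarrow> real poly) set" where
  "preservers V = {T \<in> lin_ops. T ` V \<subseteq> V}"

(* The formal series of differential operators with coefficients q.  All terms with
   i > degree f vanish, so the infinite sum is cut off there; see diff_op_altdef. *)
definition diff_op :: "(nat \<Rightarrow> real poly) \<Rightarrow> real poly \<Rightarrow> real poly" where
  "diff_op q f = (\<Sum>i\<le>degree f. q i * (pderiv ^^ i) f)"

lemma degree_pderiv_funpow: "degree ((pderiv ^^ i) (f :: real poly)) = degree f - i"
  by (induction i) (auto simp: degree_pderiv)

lemma pderiv_funpow_eq_0: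
  assumes "degree (f :: real poly) < i"
  shows "(pderiv ^^ i) f = 0"
proof -
  from assms obtain k where k: "i = Suc k" "degree f \<le> k"
    by (cases i) auto
  have "degree ((pderiv ^^ k) f) = 0"
    using k by (simp add: degree_pderiv_funpow)
  then show ?thesis
    using k by (simp add: pderiv_eq_0_iff)
qed

lemma diff_op_altdef:
  assumes "degree f \<le> n"
  shows "diff_op q f = (\<Sum>i\<le>n. q i * (pderiv ^^ i) f)"
  unfolding diff_op_def
  by (rule sum.mono_neutral_left) (use assms in \<open>auto simp: pderiv_funpow_eq_0\<close>)

definition diff_op_at :: "(nat \<Rightarrow> real poly) \<Rightarrow> real \<Rightarrow> real poly \<Rightarrow> real poly" where
  "diff_op_at q y = diff_op (\<lambda>i. [:poly (q i) y:])"

definition symbol_at :: "(nat \<Rightarrow> real poly) \<Rightarrow> real \<Rightarrow> nat \<Rightarrow> real poly" where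
  "symbol_at q y m = (\<Sum>i\<le>m. monom (poly (q i) y) i)"

definition hankel_at :: "(nat \<Rightarrow> real poly) \<Rightarrow> real \<Rightarrow> nat \<Rightarrow> real Matrix.mat" where
  "hankel_at q y m = Matrix.mat (m + 1) (m + 1) (\<lambda>(i, j). fact (i + j) * poly (q (i + j)) y)"

definition psd_mat :: "real Matrix.mat \<Rightarrow> bool" where
  "psd_mat A \<longleftrightarrow> square_mat A \<and> transpose_mat A = A \<and>
     (\<forall>x \<in> carrier_vec (dim_row A). scalar_prod x (mult_mat_vec A x) \<ge> 0)"

definition fischer :: "real poly \<Rightarrow> real poly \<Rightarrow> real" where
  "fischer f g = (\<Sum>k\<le>max (degree f) (degree g). fact k * coeff f k * coeff g k)"

definition dual_cone :: "real poly set \<Rightarrow> real poly set" where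
  "dual_cone K = {f. \<forall>g\<in>K. fischer f g \<ge> 0}"

definition moment_measures :: "real measure set" where
  "moment_measures = {\<mu>. sets \<mu> = sets borel \<and> (\<forall>m::nat. integrable \<mu> (\<lambda>t. \<bar>t ^ m\<bar>))}"

definition moment_family :: "(nat \<Rightarrow> real poly) \<Rightarrow> (real \<Rightarrow> real measure) \<Rightarrow> bool" where
  "moment_family q \<mu> \<longleftrightarrow>
     (\<forall>s. \<mu> s \<in> moment_measures) \<and>
     (\<forall>i::nat. \<exists>P :: real poly. \<forall>s. (LINT t|\<mu> s. t ^ i) = poly P s) \<and>
     (\<forall>y i. fact i * poly (q i) y = (LINT t|\<mu> y. t ^ i))"

end

theory Submission
  imports
    Defs
    "HOL-Probability.Helly_Selection"
    "HOL-Computational_Algebra.Fundamental_Theorem_Algebra"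
begin

text \<open>Let \<open>L\<^sub>y\<close> be the linear functional on polynomials with moments \<open>i! q\<^sub>i(y)\<close>. Taylor expansion gives
  \<open>T f(y) = L\<^sub>y(f(\<cdot> + y))\<close> and \<open>T\<^sub>y f(x) = L\<^sub>y(f(\<cdot> + x))\<close>, and since a real polynomial is a sum of squares
  iff it is nonnegative, assertions (1) to (4) all say that every \<open>L\<^sub>y\<close> is nonnegative on squares.
  Such a functional is integration against a measure (Hamburger): Gaussian quadrature yields
  finitely supported measures that match more and more moments, and by Helly's theorem a
  subsequence converges weakly; the bounded higher moments make all moments converge as well. If
  \<open>L\<^sub>y(p\<^sup>2) = 0\<close> for some \<open>p \<noteq> 0\<close>, the quadrature at the roots of such a \<open>p\<close> of least degree is
  already exact.\<close>

section \<open>Real polynomials\<close>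

lemma real_root_imp_linear_factor:
  fixes p :: "real poly"
  assumes "poly p t = 0" "p \<noteq> 0"
  obtains g where "p = [:-t, 1:] * g" "degree p = Suc (degree g)" "g \<noteq> 0"
proof -
  from assms(1) obtain g where g: "p = [:-t, 1:] * g"
    by (auto simp: poly_eq_0_iff_dvd elim: dvdE)
  with assms(2) have "g \<noteq> 0" by auto
  with g have "degree p = Suc (degree g)"
    by (subst g, subst degree_mult_eq) auto
  with g \<open>g \<noteq> 0\<close> that show ?thesis by blast
qed

lemma poly_nonneg_of_punctured:
  fixes p :: "real poly"
  assumes "\<And>x. x \<noteq> t \<Longrightarrow> poly p x \<ge> 0"
  shows "poly p t \<ge> 0"
proof (rule tendsto_lowerbound)
  show "(poly p \<longlongrightarrow> poly p t) (at t)"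
    using poly_isCont[of t p] by (simp add: isCont_def)
  show "\<forall>\<^sub>F x in at t. poly p x \<ge> 0"
    using assms by (auto simp: eventually_at_filter)
qed auto

text \<open>A nonnegative polynomial does not change sign at a root, so the root has multiplicity at
  least two. Dividing by the square keeps the quotient nonnegative away from \<open>t\<close>, and
  continuity covers \<open>t\<close> itself.\<close>

lemma nonneg_root_imp_square_factor:
  fixes p :: "real poly"
  assumes nonneg: "\<And>x. poly p x \<ge> 0" and "poly p t = 0" "p \<noteq> 0"
  obtains g where "p = [:-t, 1:]\<^sup>2 * g" "degree p = degree g + 2" "\<And>x. poly g x \<ge> 0"
proof -
  obtain h where h: "p = [:-t, 1:] * h" "degree p = Suc (degree h)" "h \<noteq> 0"
    using assms(2,3) by (rule real_root_imp_linear_factor)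
  have prod: "(x - t) * poly h x \<ge> 0" for x
    using nonneg[of x] by (simp add: h(1) algebra_simps)
  \<comment> \<open>Otherwise \<open>h\<close> keeps its sign near \<open>t\<close>, and
    \<open>(x - t) * poly h x\<close> is negative on one side of \<open>t\<close>.\<close>
  have "poly h t = 0"
  proof (rule ccontr)
    assume "poly h t \<noteq> 0"
    then consider "poly h t > 0" | "poly h t < 0" by linarith
    then show False
    proof cases
      case 1
      then have "\<forall>\<^sub>F x in at_left t. poly h x > 0"
        using order_tendstoD(1)[of "poly h" "poly h t" "at_left t" 0] poly_isCont[of t h]
        by (simp add: isCont_def filterlim_at_split)
      moreover have "\<forall>\<^sub>F x in at_left t. x < t"
        by (simp add: eventually_at_filter)
      ultimately have "\<forall>\<^sub>F x in at_left t. False"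
        by eventually_elim (use prod in \<open>smt (verit) mult_neg_pos\<close>)
      then show False by simp
    next
      case 2
      then have "\<forall>\<^sub>F x in at_right t. poly h x < 0"
        using order_tendstoD(2)[of "poly h" "poly h t" "at_right t" 0] poly_isCont[of t h]
        by (simp add: isCont_def filterlim_at_split)
      moreover have "\<forall>\<^sub>F x in at_right t. x > t"
        by (simp add: eventually_at_filter)
      ultimately have "\<forall>\<^sub>F x in at_right t. False"
        by eventually_elim (use prod in \<open>smt (verit) mult_pos_neg\<close>)
      then show False by simp
    qed
  qed
  then obtain g where g: "h = [:-t, 1:] * g" "degree h = Suc (degree g)"
    using h(3) by (rule real_root_imp_linear_factor)
  have pg: "p = [:-t, 1:]\<^sup>2 * g"
    by (simp only: h(1) g(1) power2_eq_square mult.assoc)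
  have "poly g x \<ge> 0" if "x \<noteq> t" for x
  proof -
    have "(x - t)\<^sup>2 * poly g x \<ge> 0"
      using nonneg[of x] by (simp add: pg)
    moreover have "(x - t)\<^sup>2 > 0" using that by simp
    ultimately show ?thesis by (simp add: zero_le_mult_iff)
  qed
  then have "poly g x \<ge> 0" for x
    using poly_nonneg_of_punctured by metis
  with pg g(2) h(2) that show ?thesis by simp
qed

lemma map_poly_of_real_add_mult:
  "map_poly (of_real :: real \<Rightarrow> complex) (p + q) = map_poly of_real p + map_poly of_real q"
  "map_poly (of_real :: real \<Rightarrow> complex) (p * q) = map_poly of_real p * map_poly of_real q"
  by (intro poly_eqI; simp add: coeff_map_poly coeff_mult)+

lemma poly_map_poly_of_real:
  "poly (map_poly (of_real :: real \<Rightarrow> complex) p) (of_real x) = of_real (poly p x)"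
  by (induction p) (simp_all add: map_poly_pCons)

text \<open>For a nonreal root \<open>z = u + iv\<close>, the factor \<open>(x - u)^2 + v^2\<close>
  is the real minimal polynomial of \<open>z\<close>. The remainder of \<open>p\<close> modulo it is
  real, of degree at most one, and vanishes at \<open>z\<close>, so it is zero.\<close>

lemma nonreal_root_imp_quadratic_factor:
  fixes p :: "real poly"
  assumes nr: "\<And>x. poly p x \<noteq> 0" and deg: "degree p > 0"
  obtains u v g where "v \<noteq> 0" "p = ([:-u, 1:]\<^sup>2 + [:v:]\<^sup>2) * g" "degree p = degree g + 2"
proof -
  let ?c = "map_poly complex_of_real"
  have "\<not> constant (poly (?c p))"
    using deg by (simp add: constant_degree degree_map_poly)
  then obtain z where z: "poly (?c p) z = 0"
    using fundamental_theorem_of_algebra by blast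
  define u v where "u = Re z" and "v = Im z"
  have zuv: "z = Complex u v" by (simp add: u_def v_def)
  have v0: "v \<noteq> 0"
  proof
    assume "v = 0"
    then have "z = complex_of_real u" by (simp add: zuv complex_eq_iff)
    with z have "poly p u = 0" by (simp add: poly_map_poly_of_real)
    with nr show False by blast
  qed
  define d where "d = [:-u, 1:]\<^sup>2 + [:v:]\<^sup>2"
  have d: "d = [:u\<^sup>2 + v\<^sup>2, -2 * u, 1:]"
    by (simp add: d_def power2_eq_square)
  have dz: "poly (?c d) z = 0"
    by (simp add: d zuv complex_eq_iff map_poly_pCons power2_eq_square algebra_simps)
  have ddeg: "degree d = 2" "d \<noteq> 0" by (simp_all add: d)
  define r where "r = p mod d"
  have rdeg: "degree r \<le> 1"
    using degree_mod_less[of d p] ddeg by (auto simp: r_def)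
  have pdr: "p = d * (p div d) + r" by (simp add: r_def)
  have "?c p = ?c d * ?c (p div d) + ?c r"
    by (subst pdr) (simp only: map_poly_of_real_add_mult)
  with z dz have rz: "poly (?c r) z = 0" by simp
  have "r = [:coeff r 0, coeff r 1:]"
    using rdeg by (intro poly_eqI) (auto simp: coeff_pCons coeff_eq_0 split: nat.splits)
  then obtain a b where r: "r = [:a, b:]" by blast
  \<comment> \<open>These are the imaginary and the real part of
    \<open>a + b * z = 0\<close>.\<close>
  have "b * v = 0" "a + b * u = 0"
    using rz by (simp_all add: r zuv map_poly_pCons complex_eq_iff algebra_simps)
  with v0 have "r = 0" by (simp add: r)
  with pdr have pd: "p = d * (p div d)" by simp
  with deg have "p div d \<noteq> 0" by auto
  have "degree p = degree d + degree (p div d)"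
    using ddeg(2) \<open>p div d \<noteq> 0\<close> degree_mult_eq[of d "p div d"] pd by metis
  with ddeg(1) pd v0 that show ?thesis unfolding d_def by (metis add.commute)
qed

text \<open>Induction on the degree: a real root splits off the square of a linear factor; without
  real roots a positive quadratic factor splits off, which is itself a sum of two squares.\<close>

lemma nonneg_poly_eq_two_squares:
  fixes p :: "real poly"
  assumes "\<And>x. poly p x \<ge> 0"
  shows "\<exists>a b. p = a\<^sup>2 + b\<^sup>2"
  using assms
proof (induction "degree p" arbitrary: p rule: less_induct)
  case less
  show ?case
  proof (cases "degree p = 0")
    case True
    then obtain c where c: "p = [:c:]" by (rule degree_eq_zeroE)
    with less.prems have "c \<ge> 0" by simp
    then have "p = [:sqrt c:]\<^sup>2 + 0\<^sup>2"
      by (simp add: c power2_eq_square)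
    then show ?thesis by blast
  next
    case False
    then have "p \<noteq> 0" by auto
    show ?thesis
    proof (cases "\<exists>t. poly p t = 0")
      case True
      then obtain t g where g: "p = [:-t, 1:]\<^sup>2 * g" "degree p = degree g + 2"
          "\<And>x. poly g x \<ge> 0"
        using nonneg_root_imp_square_factor less.prems \<open>p \<noteq> 0\<close> by metis
      then obtain a b where "g = a\<^sup>2 + b\<^sup>2" using less.hyps[of g] by auto
      with g(1) have "p = ([:-t, 1:] * a)\<^sup>2 + ([:-t, 1:] * b)\<^sup>2"
        by (simp only: power_mult_distrib distrib_left)
      then show ?thesis by blast
    next
      case noroot: False
      then obtain u v g where g: "v \<noteq> 0" "p = ([:-u, 1:]\<^sup>2 + [:v:]\<^sup>2) * g"
          "degree p = degree g + 2"
        using nonreal_root_imp_quadratic_factor[of p] False by (metis neq0_conv)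
      have "poly g x \<ge> 0" for x
      proof -
        have "(x - u)\<^sup>2 + v\<^sup>2 > 0" using g(1) by (simp add: add_nonneg_pos)
        moreover have "((x - u)\<^sup>2 + v\<^sup>2) * poly g x \<ge> 0"
          using less.prems[of x] by (simp add: g(2))
        ultimately show ?thesis by (simp add: zero_le_mult_iff)
      qed
      then obtain a b where "g = a\<^sup>2 + b\<^sup>2" using less.hyps[of g] g(3) by auto
      \<comment> \<open>The Brahmagupta-Fibonacci identity: sums of two squares are closed under
        products.\<close>
      moreover have "(s\<^sup>2 + w\<^sup>2) * (a\<^sup>2 + b\<^sup>2) = (s * a - w * b)\<^sup>2 + (s * b + w * a)\<^sup>2"
        for s w :: "real poly"
        by (simp add: power2_eq_square algebra_simps)
      ultimately show ?thesis using g(2) by blast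
    qed
  qed
qed

text \<open>Leading terms cannot cancel: the coefficient at twice the larger degree is a sum of two
  real squares, not both zero unless \<open>a\<close> and \<open>b\<close> both vanish.\<close>

lemma degree_sum_of_two_squares:
  fixes a b :: "real poly"
  shows "degree (a\<^sup>2 + b\<^sup>2) = 2 * max (degree a) (degree b)"
proof (rule antisym)
  show "degree (a\<^sup>2 + b\<^sup>2) \<le> 2 * max (degree a) (degree b)"
    by (intro degree_add_le) (auto intro!: order.trans[OF degree_power_le])
  let ?m = "max (degree a) (degree b)"
  have sq: "coeff (c\<^sup>2) (2 * m) = (coeff c m)\<^sup>2" if "degree c \<le> m" for c :: "real poly" and m
  proof (cases "degree c = m")
    case True
    then show ?thesis
      using coeff_mult_degree_sum[of c c] by (simp add: power2_eq_square mult_2)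
  next
    case False
    with that have "degree (c\<^sup>2) < 2 * m"
      by (intro le_less_trans[OF degree_power_le]) simp
    with False that show ?thesis by (simp add: coeff_eq_0)
  qed
  show "2 * ?m \<le> degree (a\<^sup>2 + b\<^sup>2)"
  proof (cases "a = 0 \<and> b = 0")
    case False
    then have "coeff a ?m \<noteq> 0 \<or> coeff b ?m \<noteq> 0 \<or> ?m = 0"
      by (metis leading_coeff_0_iff max_def degree_0 le_zero_eq)
    moreover have "coeff (a\<^sup>2 + b\<^sup>2) (2 * ?m) = (coeff a ?m)\<^sup>2 + (coeff b ?m)\<^sup>2"
      by (simp add: sq)
    ultimately show ?thesis
      by (metis le_degree mult_0_right sum_power2_eq_zero_iff zero_le)
  qed simp
qed

text \<open>The set \<open>A\<close> collects points of sign change. A polynomial taking both signs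
  has a root, which is split off; if it already lies in \<open>A\<close>, the two equal factors form
  a square that is absorbed into \<open>r\<close>, so the points stay distinct.\<close>

lemma real_poly_sign_factorization:
  fixes p :: "real poly"
  assumes "p \<noteq> 0"
  shows "\<exists>A r. finite A \<and> p = (\<Prod>t\<in>A. [:-t, 1:]) * r \<and>
           ((\<forall>x. poly r x \<ge> 0) \<or> (\<forall>x. poly r x \<le> 0))"
  using assms
proof (induction "degree p" arbitrary: p rule: less_induct)
  case less
  show ?case
  proof (cases "(\<forall>x. poly p x \<ge> 0) \<or> (\<forall>x. poly p x \<le> 0)")
    case True
    then show ?thesis by (intro exI[of _ "{}"] exI[of _ p]) simp
  next
    case False
    then obtain x y where xy: "poly p x < 0" "poly p y > 0" by (auto simp: not_le)
    then have "x \<noteq> y" by auto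
    then have "\<exists>t. poly p t = 0"
      using poly_IVT_pos[of x y p] poly_IVT_neg[of y x p] xy by (metis linorder_neqE)
    then obtain t g where g: "p = [:-t, 1:] * g" "degree p = Suc (degree g)" "g \<noteq> 0"
      using less.prems real_root_imp_linear_factor by metis
    obtain A r where A: "finite A" "g = (\<Prod>t\<in>A. [:-t, 1:]) * r"
        "(\<forall>x. poly r x \<ge> 0) \<or> (\<forall>x. poly r x \<le> 0)"
      using less.hyps[of g] g by auto
    show ?thesis
    proof (cases "t \<in> A")
      case False
      then have "p = (\<Prod>t\<in>insert t A. [:-t, 1:]) * r"
        using A(1) by (simp only: g(1) A(2) prod.insert mult.assoc simp_thms)
      with A(1,3) show ?thesis by blast
    next
      case True
      have "p = (\<Prod>t\<in>A - {t}. [:-t, 1:]) * ([:-t, 1:]\<^sup>2 * r)"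
        by (simp only: g(1) A(2) prod.remove[OF A(1) True] power2_eq_square mult_ac)
      moreover have "(\<forall>x. poly ([:-t, 1:]\<^sup>2 * r) x \<ge> 0) \<or> (\<forall>x. poly ([:-t, 1:]\<^sup>2 * r) x \<le> 0)"
        using A(3) by (auto simp: mult_nonneg_nonpos)
      ultimately show ?thesis using A(1) by blast
    qed
  qed
qed

section \<open>Gaussian quadrature\<close>

locale psd_functional =
  fixes L :: "real poly \<Rightarrow> real"
  assumes add: "L (p + q) = L p + L q"
    and smult: "L (smult c p) = c * L p"
    and square_nonneg: "L (p\<^sup>2) \<ge> 0"
begin

lemma zero: "L 0 = 0"
  using smult[of 0 0] by simp

lemma minus: "L (- p) = - L p"
  using smult[of "-1" p] by simp

lemma diff: "L (p - q) = L p - L q"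
  using add[of p "- q"] by (simp add: minus)

lemma sum: "L (\<Sum>x\<in>A. f x) = (\<Sum>x\<in>A. L (f x))"
  by (induction A rule: infinite_finite_induct) (simp_all add: zero add)

lemma nonneg:
  assumes "\<And>x. poly p x \<ge> 0"
  shows "L p \<ge> 0"
  using nonneg_poly_eq_two_squares[OF assms] square_nonneg by (auto simp: add)

text \<open>The degenerate case of Cauchy-Schwarz: \<open>L ((q + smult c p)\<^sup>2)\<close> is
  affine in \<open>c\<close> with slope \<open>2 * L (p * q)\<close>, and it is bounded below only
  if the slope is zero.\<close>

lemma mult_eq_0_if_square_eq_0:
  assumes "L (p\<^sup>2) = 0"
  shows "L (p * q) = 0"
proof (rule ccontr)
  assume nz: "L (p * q) \<noteq> 0"
  \<comment> \<open>Chosen to make the affine function take the value \<open>-1\<close>.\<close>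
  define c where "c = - (L (q\<^sup>2) + 1) / (2 * L (p * q))"
  have "(q + smult c p)\<^sup>2 = q\<^sup>2 + smult (2 * c) (p * q) + smult (c\<^sup>2) (p\<^sup>2)"
  proof -
    have "(q + [:c:] * p)\<^sup>2 = q\<^sup>2 + 2 * [:c:] * (p * q) + [:c:]\<^sup>2 * p\<^sup>2"
      by (simp only: power2_sum power_mult_distrib mult_ac add_ac)
    then show ?thesis
      by (simp add: power2_eq_square numeral_poly mult.commute[of c 2])
  qed
  then have "L ((q + smult c p)\<^sup>2) = L (q\<^sup>2) + 2 * c * L (p * q)"
    using assms by (simp add: add smult)
  also have "\<dots> = -1" using nz by (simp add: c_def field_simps)
  finally show False using square_nonneg[of "q + smult c p"] by simp
qed

text \<open>If fewer than \<open>N\<close> linear factors carried all sign changes of \<open>p\<close>, multiplying \<open>p\<close> by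
  them would give a nonzero polynomial of constant sign on which \<open>L\<close> vanishes.\<close>
lemma orthogonal_poly_splits:
  assumes pos: "\<And>q. q \<noteq> 0 \<Longrightarrow> degree q < N \<Longrightarrow> L (q\<^sup>2) \<noteq> 0"
    and p: "p \<noteq> 0" "degree p = N"
    and orth: "\<And>q. degree q < N \<Longrightarrow> L (p * q) = 0"
  obtains A c where "finite A" "card A = N" "c \<noteq> 0" "p = smult c (\<Prod>t\<in>A. [:-t, 1:])"
proof -
  obtain A r where A: "finite A" "p = (\<Prod>t\<in>A. [:-t, 1:]) * r"
    and r: "(\<forall>x. poly r x \<ge> 0) \<or> (\<forall>x. poly r x \<le> 0)"
    using real_poly_sign_factorization[OF p(1)] by blast
  define Q where "Q = (\<Prod>t\<in>A. [:-t, 1:])"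
  have Q0: "Q \<noteq> 0" using p(1) A(2) by (auto simp: Q_def)
  have Qdeg: "degree Q = card A"
    unfolding Q_def by (subst degree_prod_sum_eq) auto
  have pQ: "p = Q * r" using A(2) by (simp add: Q_def)
  then have "r \<noteq> 0" using p(1) by auto
  then have degs: "N = card A + degree r"
    using p(2) pQ Q0 Qdeg by (simp add: degree_mult_eq)
  have "\<not> card A < N"
  proof
    assume less: "card A < N"
    define s :: real where "s = (if \<forall>x. poly r x \<ge> 0 then 1 else -1)"
    have "s \<noteq> 0" by (simp add: s_def)
    have "poly (smult s r) x \<ge> 0" for x
      using r by (auto simp: s_def)
    then obtain a b where ab: "smult s r = a\<^sup>2 + b\<^sup>2"
      using nonneg_poly_eq_two_squares by blast
    have eq: "smult s (p * Q) = (Q * a)\<^sup>2 + (Q * b)\<^sup>2"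
    proof -
      have "smult s (p * Q) = Q\<^sup>2 * smult s r"
        by (simp add: pQ power2_eq_square mult_ac)
      then show ?thesis by (simp only: ab power_mult_distrib distrib_left)
    qed
    \<comment> \<open>The degree of a sum of two squares is twice the larger degree, so both
      \<open>Q * a\<close> and \<open>Q * b\<close> have degree below \<open>N\<close>, where
      \<open>L\<close> is definite.\<close>
    have "degree (smult s (p * Q)) < 2 * N"
      using \<open>s \<noteq> 0\<close> p less Q0 by (simp add: degree_mult_eq Qdeg)
    then have small: "degree (Q * a) < N" "degree (Q * b) < N"
      unfolding eq degree_sum_of_two_squares by auto
    have "L (p * Q) = 0" using orth less Qdeg by simp
    then have "L ((Q * a)\<^sup>2) + L ((Q * b)\<^sup>2) = 0"
      by (simp flip: add add: eq[symmetric] smult)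
    then have "L ((Q * a)\<^sup>2) = 0" "L ((Q * b)\<^sup>2) = 0"
      using square_nonneg[of "Q * a"] square_nonneg[of "Q * b"] by auto
    then have "Q * a = 0" "Q * b = 0"
      using pos small by blast+
    with eq have "smult s (p * Q) = 0" by simp
    then show False using \<open>s \<noteq> 0\<close> p(1) Q0 by simp
  qed
  with degs have "degree r = 0" "card A = N" by auto
  then obtain c where "r = [:c:]" by (auto elim: degree_eq_zeroE)
  then show ?thesis
    using that[of A c] A(1) \<open>card A = N\<close> \<open>r \<noteq> 0\<close> pQ by (simp add: Q_def)
qed

end

section \<open>Lagrange interpolation and quadrature\<close>

lemma poly_eq_0_if_many_roots:
  fixes p :: "real poly"
  assumes "p = 0 \<or> degree p < card A" "\<And>t. t \<in> A \<Longrightarrow> poly p t = 0"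
  shows "p = 0"
proof (rule ccontr)
  assume nz: "p \<noteq> 0"
  then have "card A \<le> card {x. poly p x = 0}"
    using assms(2) by (intro card_mono poly_roots_finite) auto
  also have "\<dots> \<le> degree p"
    using nz by (rule card_poly_roots_bound)
  finally show False using assms(1) nz by simp
qed

definition lagrange_basis :: "real set \<Rightarrow> real \<Rightarrow> real poly" where
  "lagrange_basis A t = smult (1 / (\<Prod>s\<in>A - {t}. t - s)) (\<Prod>s\<in>A - {t}. [:-s, 1:])"

lemma poly_lagrange_basis:
  assumes "finite A" "t \<in> A" "s \<in> A"
  shows "poly (lagrange_basis A t) s = (if s = t then 1 else 0)"
  using assms by (auto simp: lagrange_basis_def poly_prod)

lemma degree_lagrange_basis:
  assumes "finite A" "t \<in> A"
  shows "degree (lagrange_basis A t) < card A"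
proof -
  have "degree (lagrange_basis A t) \<le> degree (\<Prod>s\<in>A - {t}. [:-s, 1:])"
    unfolding lagrange_basis_def by (rule degree_smult_le)
  also have "\<dots> = card (A - {t})"
    by (subst degree_prod_sum_eq) auto
  also have "\<dots> < card A"
    using assms by (rule card_Diff1_less)
  finally show ?thesis .
qed

context psd_functional
begin

text \<open>The nodes are the roots of \<open>p\<close>, the weights the values of \<open>L\<close>
  at the Lagrange basis. Since \<open>f mod p\<close> is interpolated exactly, only the multiple of
  \<open>p\<close> could cause an error. Stating exactness through
  \<open>L (p * (f div p)) = 0\<close> serves both a \<open>p\<close> orthogonal to everything and
  an \<open>f\<close> of degree below \<open>N\<close>.\<close>

lemma gauss_quadrature:
  assumes pos: "\<And>q. q \<noteq> 0 \<Longrightarrow> degree q < N \<Longrightarrow> L (q\<^sup>2) \<noteq> 0"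
    and p: "p \<noteq> 0" "degree p = N"
    and orth: "\<And>q. degree q < N \<Longrightarrow> L (p * q) = 0"
  shows "\<exists>A w. finite A \<and> (\<forall>t\<in>A. w t \<ge> 0) \<and>
           (\<forall>f. L (p * (f div p)) = 0 \<longrightarrow> L f = (\<Sum>t\<in>A. w t * poly f t))"
proof -
  obtain A c where A: "finite A" "card A = N" "c \<noteq> 0" "p = smult c (\<Prod>t\<in>A. [:-t, 1:])"
    using orthogonal_poly_splits[OF pos p orth] by blast
  have root: "poly p t = 0" if "t \<in> A" for t
    using that A by (simp add: poly_prod)
  have modA: "poly (f mod p) t = poly f t" if "t \<in> A" for f t
  proof -
    have "poly f t = poly p t * poly (f div p) t + poly (f mod p) t"
      by (metis mult_div_mod_eq poly_add poly_mult)
    then show ?thesis using root[OF that] by simp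
  qed
  have mod_deg: "f mod p = 0 \<or> degree (f mod p) < card A" for f
    using degree_mod_less[of p f] p A(2) by auto
  let ?l = "lagrange_basis A"
  have weight: "L (?l t) \<ge> 0" if t: "t \<in> A" for t
  proof -
    \<comment> \<open>The basis polynomial takes only the values 0 and 1 at the nodes, so
      \<open>p\<close> divides \<open>g\<close>. The quotient has degree below \<open>N\<close>,
      hence \<open>L g = 0\<close> and the weight equals \<open>L\<close> of a square.\<close>
    define g where "g = (?l t)\<^sup>2 - ?l t"
    have "g mod p = 0"
      using A(1) t by (intro poly_eq_0_if_many_roots[OF mod_deg])
        (simp add: modA g_def poly_lagrange_basis)
    then have g: "g = p * (g div p)" by (metis add_0_right mult_div_mod_eq)
    have "degree (g div p) < N"
    proof (cases "g div p = 0")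
      case True
      then show ?thesis using degree_lagrange_basis[OF A(1) t] A(2) by simp
    next
      case False
      have "degree g \<le> max (degree ((?l t)\<^sup>2)) (degree (?l t))"
        unfolding g_def by (rule degree_diff_le_max)
      also have "\<dots> < 2 * N"
        using degree_lagrange_basis[OF A(1) t] A(2) degree_power_le[of "?l t" 2] by auto
      finally have "degree p + degree (g div p) < 2 * N"
        using g False p(1) by (metis degree_mult_eq)
      then show ?thesis by (simp add: p(2))
    qed
    with orth g have "L g = 0" by metis
    then show ?thesis using square_nonneg[of "?l t"] by (simp add: g_def diff)
  qed
  have "L f = (\<Sum>t\<in>A. L (?l t) * poly f t)" if f: "L (p * (f div p)) = 0" for f
  proof -
    let ?s = "\<Sum>t\<in>A. smult (poly f t) (?l t)"
    have "f mod p - ?s = 0"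
    proof (rule poly_eq_0_if_many_roots)
      show "f mod p - ?s = 0 \<or> degree (f mod p - ?s) < card A"
      \<comment> \<open>Without nodes \<open>p\<close> is a nonzero constant and every remainder is
        zero; the strict degree bound on the interpolant needs at least one node.\<close>
      proof (cases "card A = 0")
        case True
        then show ?thesis using A(1) mod_deg[of f] by simp
      next
        case False
        have "degree ?s < card A"
          using False A(1) degree_lagrange_basis
          by (intro degree_sum_less) (auto intro: le_less_trans[OF degree_smult_le])
        moreover have "degree (f mod p) < card A"
          using mod_deg[of f] False by auto
        ultimately show ?thesis
          by (metis degree_diff_less)
      qed
      show "poly (f mod p - ?s) t = 0" if "t \<in> A" for t
      proof -
        have "poly ?s t = (\<Sum>u\<in>A. if u = t then poly f u else 0)"
          unfolding poly_sum using that A(1)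
          by (intro sum.cong) (auto simp: poly_lagrange_basis)
        also have "\<dots> = poly f t" using that A(1) by simp
        finally show ?thesis using that by (simp add: modA)
      qed
    qed
    then have "L (f mod p) = L ?s" by simp
    moreover have "L f = L (p * (f div p)) + L (f mod p)"
      by (simp flip: add)
    ultimately show ?thesis using f by (simp add: sum smult mult.commute)
  qed
  with A(1) weight show ?thesis by (intro exI[of _ A] exI[of _ "\<lambda>t. L (?l t)"]) blast
qed

text \<open>Gram-Schmidt by induction on the dimension \<open>N\<close>. Degree below
  \<open>N\<close> is expressed by vanishing coefficients, so that \<open>N = 0\<close> gives the
  zero space.\<close>

lemma orthogonal_projection:
  assumes "\<And>q. q \<noteq> 0 \<Longrightarrow> L (q\<^sup>2) \<noteq> 0"
  shows "\<exists>r. (\<forall>n\<ge>N. coeff r n = 0) \<and> (\<forall>q. (\<forall>n\<ge>N. coeff q n = 0) \<longrightarrow> L ((f - r) * q) = 0)"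
proof (induction N arbitrary: f)
  case 0
  have "L ((f - 0) * q) = 0" if "\<forall>n\<ge>0. coeff q n = 0" for q
  proof -
    have "q = 0" using that by (simp add: poly_eq_iff)
    then show ?thesis by (simp add: zero)
  qed
  then show ?case by (metis coeff_0)
next
  case (Suc N)
  obtain r0 where r0: "\<forall>n\<ge>N. coeff r0 n = 0"
      "\<And>q. \<forall>n\<ge>N. coeff q n = 0 \<Longrightarrow> L ((monom 1 N - r0) * q) = 0"
    using Suc.IH[of "monom 1 N"] by blast
  obtain r1 where r1: "\<forall>n\<ge>N. coeff r1 n = 0"
      "\<And>q. \<forall>n\<ge>N. coeff q n = 0 \<Longrightarrow> L ((f - r1) * q) = 0"
    using Suc.IH[of f] by blast
  \<comment> \<open>The new basis vector: the monomial minus its projection, orthogonal to all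
    polynomials of degree below \<open>N\<close>.\<close>
  define e where "e = monom 1 N - r0"
  have eN: "coeff e N = 1" and e_high: "\<And>n. n > N \<Longrightarrow> coeff e n = 0"
    using r0(1) by (auto simp: e_def)
  have "e \<noteq> 0" using eN by auto
  with assms have e2: "L (e\<^sup>2) \<noteq> 0" by blast
  \<comment> \<open>The Fourier coefficient of \<open>f - r1\<close> along \<open>e\<close>.\<close>
  define c where "c = L ((f - r1) * e) / L (e\<^sup>2)"
  have "L ((f - (r1 + smult c e)) * q) = 0" if q: "\<forall>n\<ge>Suc N. coeff q n = 0" for q
  proof -
    define a where "a = coeff q N"
    define q' where "q' = q - smult a e"
    have q': "\<forall>n\<ge>N. coeff q' n = 0"
    proof (intro allI impI)
      fix n assume "n \<ge> N"
      then consider "n = N" | "n > N" by linarith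
      then show "coeff q' n = 0"
        using q eN e_high by cases (simp_all add: q'_def a_def Suc_le_eq)
    qed
    \<comment> \<open>With \<open>q\<close> split into \<open>q'\<close> and its \<open>e\<close>
      part, \<open>L\<close> kills both terms containing \<open>q'\<close>, and the choice of
      \<open>c\<close> cancels the other two.\<close>
    have "(f - (r1 + smult c e)) * q =
        (f - r1) * q' + smult a ((f - r1) * e) - smult c (e * q') - smult (c * a) (e\<^sup>2)"
    proof -
      have q_eq: "q = q' + smult a e" by (simp add: q'_def)
      show ?thesis
        unfolding q_eq
        by (simp add: algebra_simps power2_eq_square smult_add_right smult_diff_right)
    qed
    then have "L ((f - (r1 + smult c e)) * q) = a * L ((f - r1) * e) - c * a * L (e\<^sup>2)"
      using r0(2)[OF q'] r1(2)[OF q'] by (simp add: add diff smult e_def)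
    then show ?thesis using e2 by (simp add: c_def)
  qed
  moreover have "\<forall>n\<ge>Suc N. coeff (r1 + smult c e) n = 0"
    using r1(1) e_high by simp
  ultimately show ?case by blast
qed

text \<open>A null polynomial of least degree is orthogonal to everything, and minimality makes
  \<open>L\<close> definite below its degree, so its quadrature is exact for all \<open>f\<close>.
  If \<open>L\<close> is definite, the orthogonal polynomial of degree \<open>n + 1\<close> is used,
  and every \<open>f\<close> of degree at most \<open>n\<close> is its own remainder.\<close>

lemma finite_quadrature:
  "\<exists>A w. finite A \<and> (\<forall>t\<in>A. w t \<ge> 0) \<and>
     (\<forall>f. degree f \<le> n \<longrightarrow> L f = (\<Sum>t\<in>A. w t * poly f t))"
proof (cases "\<exists>p. p \<noteq> 0 \<and> L (p\<^sup>2) = 0")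
  case True
  then obtain p where p: "p \<noteq> 0" "L (p\<^sup>2) = 0"
    and min: "\<And>q. q \<noteq> 0 \<Longrightarrow> L (q\<^sup>2) = 0 \<Longrightarrow> degree p \<le> degree q"
    using ex_has_least_nat[of "\<lambda>p. p \<noteq> 0 \<and> L (p\<^sup>2) = 0" _ degree] by blast
  have "L (p * q) = 0" for q
    using p(2) by (rule mult_eq_0_if_square_eq_0)
  then show ?thesis
    using gauss_quadrature[of "degree p" p] p(1) min by (metis leD)
next
  case False
  then have pos: "\<And>q. q \<noteq> 0 \<Longrightarrow> L (q\<^sup>2) \<noteq> 0" by blast
  obtain r where r: "\<forall>k\<ge>Suc n. coeff r k = 0"
      "\<And>q. \<forall>k\<ge>Suc n. coeff q k = 0 \<Longrightarrow> L ((monom 1 (Suc n) - r) * q) = 0"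
    using orthogonal_projection[OF pos, of "Suc n" "monom 1 (Suc n)"] by blast
  define p where "p = monom 1 (Suc n) - r"
  have p1: "coeff p (Suc n) = 1" using r(1) by (simp add: p_def)
  then have "p \<noteq> 0" by auto
  have deg: "degree p = Suc n"
  proof (rule antisym)
    show "degree p \<le> Suc n" using r(1) by (intro degree_le) (auto simp: p_def)
    show "Suc n \<le> degree p" using p1 by (intro le_degree) simp
  qed
  have "L (p * q) = 0" if "degree q < Suc n" for q
    unfolding p_def using that by (intro r(2)) (auto simp: coeff_eq_0)
  then obtain A w where "finite A" "\<forall>t\<in>A. w t \<ge> 0"
      "\<forall>f. L (p * (f div p)) = 0 \<longrightarrow> L f = (\<Sum>t\<in>A. w t * poly f t)"
    using gauss_quadrature[of "Suc n" p] \<open>p \<noteq> 0\<close> deg pos by metis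
  moreover have "f div p = 0" if "degree f \<le> n" for f
    using that deg by (intro div_poly_less) simp
  ultimately show ?thesis by (metis mult_zero_right zero)
qed

end

section \<open>The Hamburger moment problem\<close>

text \<open>A point measure lives on the power set of \<open>A\<close>; pushing it forward along the
  identity gives a distribution on the Borel sets of the line, as weak convergence requires.\<close>

lemma finite_discrete_distribution:
  fixes A :: "real set" and w :: "real \<Rightarrow> real"
  assumes "finite A" "\<And>t. t \<in> A \<Longrightarrow> w t \<ge> 0" "(\<Sum>t\<in>A. w t) = 1"
  shows "\<exists>M. real_distribution M \<and> (\<forall>f :: real \<Rightarrow> real. f \<in> borel_measurable borel \<longrightarrow>
           integrable M f \<and> (LINT t|M. f t) = (\<Sum>t\<in>A. w t * f t))"
proof -
  define P where "P = point_measure A w"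
  define M where "M = distr P borel (\<lambda>t. t)"
  have meas: "(\<lambda>t. t) \<in> measurable P borel"
    by (simp add: P_def)
  interpret P: prob_space P
    unfolding P_def using assms by (intro prob_space_point_measure) auto
  have "prob_space M"
    unfolding M_def by (rule P.prob_space_distr[OF meas])
  then have "real_distribution M"
    by (simp add: real_distribution_def real_distribution_axioms_def M_def)
  moreover have "integrable M f \<and> (LINT t|M. f t) = (\<Sum>t\<in>A. w t * f t)"
    if f: "f \<in> borel_measurable borel" for f :: "real \<Rightarrow> real"
    unfolding M_def integrable_distr_eq[OF meas f] integral_distr[OF meas f]
    unfolding P_def using assms
    by (simp add: integrable_point_measure_finite lebesgue_integral_point_measure_finite)
  ultimately show ?thesis by blast
qed

text \<open>Chebyshev's inequality, for the half-open intervals that occur in the definition of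
  tightness.\<close>

lemma (in real_distribution) measure_interval_ge_second_moment:
  assumes "R > 0" "integrable M (\<lambda>t. t\<^sup>2)"
  shows "measure M {-R<..R} \<ge> 1 - (LINT t|M. t\<^sup>2) / R\<^sup>2"
proof -
  have "(LINT t|M. 1 - t\<^sup>2 / R\<^sup>2) \<le> (LINT t|M. indicator {-R<..R} t)"
  proof (rule integral_mono)
    show "integrable M (\<lambda>t. 1 - t\<^sup>2 / R\<^sup>2)" using assms(2) by simp
    show "integrable M (indicator {-R<..R} :: real \<Rightarrow> real)"
      by (simp add: integrable_indicator_iff less_top[symmetric])
    fix t :: real
    show "1 - t\<^sup>2 / R\<^sup>2 \<le> indicator {-R<..R} t"
    proof (cases "t \<in> {-R<..R}")
      case False
      then have "\<bar>R\<bar> \<le> \<bar>t\<bar>" using assms(1) by auto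
      then have "R\<^sup>2 \<le> t\<^sup>2" by (simp add: abs_le_square_iff)
      with False assms(1) show ?thesis by simp
    qed simp
  qed
  also have "(LINT t|M. 1 - t\<^sup>2 / R\<^sup>2) = 1 - (LINT t|M. t\<^sup>2) / R\<^sup>2"
    using assms(2) prob_space by simp
  finally show ?thesis by simp
qed

lemma tight_if_bounded_second_moments:
  assumes "\<And>n. real_distribution (\<nu> n)" "\<And>n. integrable (\<nu> n) (\<lambda>t. t\<^sup>2)"
    and bound: "\<And>n. (LINT t|\<nu> n. t\<^sup>2) \<le> C"
  shows "tight \<nu>"
  unfolding tight_def
proof (intro conjI allI impI)
  fix \<epsilon> :: real assume \<epsilon>: "\<epsilon> > 0"
  \<comment> \<open>The summand 1 gives \<open>R \<le> R\<^sup>2\<close>, so that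
    \<open>\<bar>C\<bar> < \<epsilon> * R\<close> already yields
    \<open>C / R\<^sup>2 < \<epsilon>\<close>.\<close>
  define R where "R = 1 + \<bar>C\<bar> / \<epsilon>"
  have R: "R \<ge> 1" using \<epsilon> by (simp add: R_def)
  have "\<bar>C\<bar> < \<epsilon> * R" using \<epsilon> by (simp add: R_def distrib_left)
  also have "\<dots> \<le> \<epsilon> * R\<^sup>2"
    using R \<epsilon> self_le_power[of R 2] by (intro mult_left_mono) auto
  finally have CR: "C / R\<^sup>2 < \<epsilon>" using R by (simp add: divide_less_eq)
  have "measure (\<nu> n) {-R<..R} > 1 - \<epsilon>" for n
  proof -
    interpret real_distribution "\<nu> n" by fact
    have "(LINT t|\<nu> n. t\<^sup>2) / R\<^sup>2 \<le> C / R\<^sup>2"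
      using bound by (intro divide_right_mono) auto
    then show ?thesis
      using measure_interval_ge_second_moment[of R] R assms(2)[of n] CR by fastforce
  qed
  then show "\<exists>a b. a < b \<and> (\<forall>n. measure (\<nu> n) {a<..b} > 1 - \<epsilon>)"
    using R by (intro exI[of _ "-R"] exI[of _ R]) auto
qed fact

section \<open>Convergence of moments under weak convergence\<close>

definition clip :: "real \<Rightarrow> real \<Rightarrow> real" where
  "clip R y = max (- R) (min R y)"

text \<open>Clipping changes nothing on \<open>[-R, R]\<close>; outside, the error is at most
  \<open>\<bar>y\<bar>\<close>, and \<open>\<bar>y\<bar> > R\<close> gives
  \<open>\<bar>y\<bar> \<le> y\<^sup>2 / R\<close>.\<close>

lemma abs_diff_clip_le:
  assumes "R > 0"
  shows "\<bar>y - clip R y\<bar> \<le> y\<^sup>2 / R"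
proof (cases "\<bar>y\<bar> \<le> R")
  case True
  then have "clip R y = y" by (auto simp: clip_def)
  then show ?thesis using assms by simp
next
  case False
  then have "\<bar>y\<bar> * R \<le> \<bar>y\<bar> * \<bar>y\<bar>" by (intro mult_left_mono) auto
  then have "\<bar>y\<bar> \<le> y\<^sup>2 / R" using assms by (simp add: pos_le_divide_eq power2_eq_square)
  moreover have "\<bar>y - clip R y\<bar> \<le> \<bar>y\<bar>" using False assms by (auto simp: clip_def)
  ultimately show ?thesis by simp
qed

lemma integral_diff_clip_le:
  fixes f :: "real \<Rightarrow> real"
  assumes "R > 0" "integrable M f" "integrable M (\<lambda>t. clip R (f t))" "integrable M (\<lambda>t. (f t)\<^sup>2)"
  shows "\<bar>(LINT t|M. f t) - (LINT t|M. clip R (f t))\<bar> \<le> (LINT t|M. (f t)\<^sup>2) / R"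
proof -
  have "\<bar>(LINT t|M. f t) - (LINT t|M. clip R (f t))\<bar> = \<bar>LINT t|M. f t - clip R (f t)\<bar>"
    using assms by simp
  also have "\<dots> \<le> (LINT t|M. \<bar>f t - clip R (f t)\<bar>)"
    by (rule integral_abs_bound)
  also have "\<dots> \<le> (LINT t|M. (f t)\<^sup>2 / R)"
    using assms by (intro integral_mono abs_diff_clip_le) auto
  finally show ?thesis by simp
qed

text \<open>The second moments of \<open>f\<close> bound the integral of \<open>f - clip R f\<close> uniformly by \<open>C / R\<close>, so the
  bounded continuous test functions \<open>clip R f\<close> determine the limit.\<close>
lemma weak_conv_integral_square_bounded:
  fixes f :: "real \<Rightarrow> real"
  assumes \<nu>: "\<And>n. real_distribution (\<nu> n)" and M: "real_distribution M"
    and conv: "weak_conv_m \<nu> M" and cont: "\<And>x. isCont f x"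
    and int: "\<And>n. integrable (\<nu> n) f" "\<And>n. integrable (\<nu> n) (\<lambda>t. (f t)\<^sup>2)"
    and bound: "\<forall>\<^sub>F n in sequentially. (LINT t|\<nu> n. (f t)\<^sup>2) \<le> C"
    and lim: "(\<lambda>n. LINT t|\<nu> n. f t) \<longlonglongrightarrow> l"
  shows "integrable M f" "(LINT t|M. f t) = l"
proof -
  interpret M: real_distribution M by fact
  have [measurable]: "f \<in> borel_measurable borel"
    using cont by (intro borel_measurable_continuous_onI continuous_at_imp_continuous_on) simp
  have bdd_conv: "(\<lambda>n. LINT t|\<nu> n. g t) \<longlonglongrightarrow> (LINT t|M. g t)"
    if "\<And>x. isCont g x" "\<And>x. \<bar>g x\<bar> \<le> B" for g :: "real \<Rightarrow> real" and B
    using weak_conv_imp_integral_bdd_continuous_conv[OF \<nu> M conv, of g B] that by simp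
  have square: "integrable M (\<lambda>t. (f t)\<^sup>2) \<and> (LINT t|M. (f t)\<^sup>2) \<le> C"
  proof -
    \<comment> \<open>Each truncation is bounded and continuous, so the bound \<open>C\<close>
      passes to its integral under \<open>M\<close>; monotone convergence in \<open>j\<close> then
      gives it for the square of \<open>f\<close>.\<close>
    define g where "g j t = min (real j) ((f t)\<^sup>2)" for j :: nat and t
    have [measurable]: "g j \<in> borel_measurable borel" for j
      unfolding g_def by measurable
    have g_abs: "\<bar>g j t\<bar> \<le> real j" for j t by (simp add: g_def)
    have g_int: "integrable M (g j)" for j
      by (rule M.integrable_const_bound[of _ "real j"]) (use g_abs in auto)
    have g_le: "(LINT t|M. g j t) \<le> C" for j
    proof (rule tendsto_upperbound)
      show "(\<lambda>n. LINT t|\<nu> n. g j t) \<longlonglongrightarrow> (LINT t|M. g j t)"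
        using cont by (intro bdd_conv[OF _ g_abs]) (auto simp: g_def intro!: continuous_intros)
      show "\<forall>\<^sub>F n in sequentially. (LINT t|\<nu> n. g j t) \<le> C"
        using bound
      proof eventually_elim
        case (elim n)
        interpret real_distribution "\<nu> n" by (rule \<nu>)
        have "integrable (\<nu> n) (g j)"
          by (rule integrable_const_bound[of _ "real j"]) (use g_abs in auto)
        then have "(LINT t|\<nu> n. g j t) \<le> (LINT t|\<nu> n. (f t)\<^sup>2)"
          using int(2) by (intro integral_mono) (auto simp: g_def)
        with elim show ?case by simp
      qed
    qed simp
    have g_inc: "incseq (\<lambda>j. LINT t|M. g j t)"
      by (intro incseq_SucI integral_mono g_int) (simp add: g_def)
    then obtain c where c: "(\<lambda>j. LINT t|M. g j t) \<longlonglongrightarrow> c"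
      using g_le incseq_convergent by metis
    have g_lim: "(\<lambda>j. g j t) \<longlonglongrightarrow> (f t)\<^sup>2" for t
    proof (rule tendsto_eventually)
      obtain j0 :: nat where "(f t)\<^sup>2 \<le> real j0" using real_arch_simple by blast
      then show "\<forall>\<^sub>F j in sequentially. g j t = (f t)\<^sup>2"
        unfolding eventually_sequentially g_def
        by (intro exI[of _ j0]) (auto simp: min_def)
    qed
    have mono: "AE t in M. mono (\<lambda>j. g j t)"
      by (auto simp: g_def mono_def)
    have "integrable M (\<lambda>t. (f t)\<^sup>2)" "(LINT t|M. (f t)\<^sup>2) = c"
      using integrable_monotone_convergence[OF g_int mono _ c, of "\<lambda>t. (f t)\<^sup>2"]
        integral_monotone_convergence[OF g_int mono _ c, of "\<lambda>t. (f t)\<^sup>2"] g_lim by auto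
    moreover have "c \<le> C" using c g_le by (intro LIMSEQ_le_const2) auto
    ultimately show ?thesis by simp
  qed
  have "\<bar>f t\<bar> \<le> 1 + (f t)\<^sup>2" for t
    using zero_le_power2[of "\<bar>f t\<bar> - 1"] zero_le_power2[of "f t"]
    unfolding power2_diff by simp
  then show f_int: "integrable M f"
    using square by (intro Bochner_Integration.integrable_bound[of M "\<lambda>t. 1 + (f t)\<^sup>2" f]) auto
  \<comment> \<open>Both \<open>l\<close> and the integral of \<open>f\<close> are within
    \<open>C / R\<close> of the integral of the clipped function under \<open>M\<close>; afterwards
    \<open>R\<close> tends to infinity.\<close>
  have close: "\<bar>(LINT t|M. f t) - l\<bar> \<le> 2 * C / R" if R: "R > 0" for R
  proof -
    have clip_abs: "\<bar>clip R y\<bar> \<le> R" for y using R by (auto simp: clip_def)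
    have [measurable]: "(\<lambda>t. clip R (f t)) \<in> borel_measurable borel"
      unfolding clip_def by measurable
    have clip_int: "integrable N (\<lambda>t. clip R (f t))" if "real_distribution N" for N
    proof -
      interpret real_distribution N by fact
      show ?thesis
        by (rule integrable_const_bound[of _ R]) (use clip_abs in auto)
    qed
    have "(\<lambda>n. LINT t|\<nu> n. clip R (f t)) \<longlonglongrightarrow> (LINT t|M. clip R (f t))"
      using clip_abs cont by (intro bdd_conv) (auto simp: clip_def intro!: continuous_intros)
    then have "(\<lambda>n. \<bar>(LINT t|\<nu> n. f t) - (LINT t|\<nu> n. clip R (f t))\<bar>)
        \<longlonglongrightarrow> \<bar>l - (LINT t|M. clip R (f t))\<bar>"
      using lim by (intro tendsto_intros)
    moreover have "\<forall>\<^sub>F n in sequentially.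
        \<bar>(LINT t|\<nu> n. f t) - (LINT t|\<nu> n. clip R (f t))\<bar> \<le> C / R"
      using bound
    proof eventually_elim
      case (elim n)
      then have "(LINT t|\<nu> n. (f t)\<^sup>2) / R \<le> C / R"
        using R by (intro divide_right_mono) auto
      then show ?case
        using integral_diff_clip_le[OF R int(1) clip_int[OF \<nu>] int(2), of n] by linarith
    qed
    ultimately have "\<bar>l - (LINT t|M. clip R (f t))\<bar> \<le> C / R"
      by (rule tendsto_upperbound) simp
    moreover have "(LINT t|M. (f t)\<^sup>2) / R \<le> C / R"
      using R square by (intro divide_right_mono) auto
    ultimately show ?thesis
      using integral_diff_clip_le[OF R f_int clip_int[OF M]] square by fastforce
  qed
  have "((\<lambda>R. 2 * C / R) \<longlongrightarrow> 0) at_top"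
    by (intro tendsto_divide_0[OF tendsto_const] filterlim_at_top_imp_at_infinity filterlim_ident)
  moreover have "\<forall>\<^sub>F R in at_top. \<bar>(LINT t|M. f t) - l\<bar> \<le> 2 * C / R"
    using eventually_gt_at_top[of "0::real"] by eventually_elim (rule close)
  ultimately have "\<bar>(LINT t|M. f t) - l\<bar> \<le> 0"
    by (rule tendsto_lowerbound) simp
  then show "(LINT t|M. f t) = l" by simp
qed

section \<open>Representing measures for positive functionals\<close>

context psd_functional
begin

lemma hamburger_normalized:
  assumes L1: "L 1 = 1"
  shows "\<exists>M. real_distribution M \<and>
           (\<forall>k. integrable M (\<lambda>t. t ^ k) \<and> (LINT t|M. t ^ k) = L (monom 1 k))"
proof -
  \<comment> \<open>The offset 2 makes every approximating distribution, from \<open>n = 0\<close>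
    on, have the prescribed second moment; this gives tightness.\<close>
  have "\<exists>M. real_distribution M \<and> (\<forall>k. integrable M (\<lambda>t. t ^ k)) \<and>
          (\<forall>k\<le>n + 2. (LINT t|M. t ^ k) = L (monom 1 k))" for n
  proof -
    obtain A w where A: "finite A" "\<forall>t\<in>A. w t \<ge> 0"
      and L: "\<And>f. degree f \<le> n + 2 \<Longrightarrow> L f = (\<Sum>t\<in>A. w t * poly f t)"
      using finite_quadrature[of "n + 2"] by blast
    have "(\<Sum>t\<in>A. w t) = 1" using L[of 1] L1 by simp
    then obtain M where "real_distribution M" "\<forall>f :: real \<Rightarrow> real. f \<in> borel_measurable borel \<longrightarrow>
           integrable M f \<and> (LINT t|M. f t) = (\<Sum>t\<in>A. w t * f t)"
      using finite_discrete_distribution[of A w] A by blast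
    moreover have "L (monom 1 k) = (\<Sum>t\<in>A. w t * t ^ k)" if "k \<le> n + 2" for k
      using L[of "monom 1 k"] that by (simp add: degree_monom_eq poly_monom)
    ultimately show ?thesis by (intro exI[of _ M]) auto
  qed
  then obtain \<nu> where \<nu>: "\<And>n. real_distribution (\<nu> n)"
    and int: "\<And>n k. integrable (\<nu> n) (\<lambda>t. t ^ k)"
    and mom: "\<And>n k. k \<le> n + 2 \<Longrightarrow> (LINT t|\<nu> n. t ^ k) = L (monom 1 k)"
    by metis
  have "tight \<nu>"
    by (rule tight_if_bounded_second_moments[OF \<nu> int, where C = "L (monom 1 2)"]) (simp add: mom)
  then obtain r M where r: "strict_mono r" and M: "real_distribution M"
    and conv: "weak_conv_m (\<nu> \<circ> id \<circ> r) M"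
    using tight_imp_convergent_subsubsequence[of \<nu> id] by (auto simp: strict_mono_def)
  \<comment> \<open>Along the subsequence each moment is eventually constant. Applied to order
    \<open>2k\<close> this bounds the squares of \<open>t ^ k\<close>, applied to order
    \<open>k\<close> it gives the limit.\<close>
  have evt: "\<forall>\<^sub>F n in sequentially. (LINT t|(\<nu> \<circ> id \<circ> r) n. t ^ k) = L (monom 1 k)" for k
    unfolding eventually_sequentially
  proof (intro exI allI impI)
    fix n assume "k \<le> n"
    then have "k \<le> r n + 2" using seq_suble[OF r, of n] by linarith
    then show "(LINT t|(\<nu> \<circ> id \<circ> r) n. t ^ k) = L (monom 1 k)" by (simp add: mom)
  qed
  have "integrable M (\<lambda>t. t ^ k) \<and> (LINT t|M. t ^ k) = L (monom 1 k)" for k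
  proof -
    have sq: "(t ^ k)\<^sup>2 = t ^ (k * 2)" for t :: real by (simp add: power_mult)
    have "\<forall>\<^sub>F n in sequentially. (LINT t|(\<nu> \<circ> id \<circ> r) n. (t ^ k)\<^sup>2) \<le> L (monom 1 (k * 2))"
      unfolding sq using evt[of "k * 2"] by eventually_elim simp
    moreover have "(\<lambda>n. LINT t|(\<nu> \<circ> id \<circ> r) n. t ^ k) \<longlonglongrightarrow> L (monom 1 k)"
      using evt by (rule tendsto_eventually)
    moreover have "real_distribution ((\<nu> \<circ> id \<circ> r) n)"
      "integrable ((\<nu> \<circ> id \<circ> r) n) (\<lambda>t. t ^ k)"
      "integrable ((\<nu> \<circ> id \<circ> r) n) (\<lambda>t. (t ^ k)\<^sup>2)" for n
      using \<nu> int by (simp_all add: sq)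
    ultimately show ?thesis
      using weak_conv_integral_square_bounded[OF _ M conv, of "\<lambda>t. t ^ k"] by simp
  qed
  with M show ?thesis by blast
qed

text \<open>Normalization by \<open>L 1\<close> reduces to probability distributions, and a constant
  density restores the total mass. Keeping the factor \<open>L 1\<close> under the integral treats
  zero mass uniformly.\<close>

theorem hamburger:
  "\<exists>M. sets M = sets borel \<and>
     (\<forall>k. integrable M (\<lambda>t. t ^ k) \<and> (LINT t|M. t ^ k) = L (monom 1 k))"
proof -
  have L1: "L 1 \<ge> 0" using square_nonneg[of 1] by simp
  have "\<exists>N. sets N = sets borel \<and> (\<forall>k. integrable N (\<lambda>t. L 1 * t ^ k) \<and>
          (LINT t|N. L 1 * t ^ k) = L (monom 1 k))"
  proof (cases "L 1 = 0")
    case True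
    \<comment> \<open>With \<open>L 1 = 0\<close> the constant 1 is a null polynomial, so
      Cauchy-Schwarz makes all moments vanish.\<close>
    then have "L (monom 1 k) = 0" for k
      using mult_eq_0_if_square_eq_0[of 1 "monom 1 k"] by simp
    with True show ?thesis by (intro exI[of _ borel]) simp
  next
    case False
    interpret normalized: psd_functional "\<lambda>p. L p / L 1"
      using L1 square_nonneg by unfold_locales (simp_all add: add smult add_divide_distrib)
    obtain N where "real_distribution N"
        "\<forall>k. integrable N (\<lambda>t. t ^ k) \<and> (LINT t|N. t ^ k) = L (monom 1 k) / L 1"
      using normalized.hamburger_normalized False by auto
    with False show ?thesis
      by (intro exI[of _ N]) (simp add: real_distribution.events_eq_borel)
  qed
  then obtain N where N: "sets N = sets borel"
      "\<And>k. integrable N (\<lambda>t. L 1 * t ^ k)" "\<And>k. (LINT t|N. L 1 * t ^ k) = L (monom 1 k)"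
    by blast
  have [measurable]: "(\<lambda>t. t ^ k :: real) \<in> borel_measurable N" for k
    using N(1) by (simp add: measurable_cong_sets[OF N(1) refl])
  have "integrable (density N (\<lambda>_. L 1)) (\<lambda>t. t ^ k)"
    "(LINT t|density N (\<lambda>_. L 1). t ^ k) = L (monom 1 k)" for k
    using N L1 by (simp_all add: integrable_density integral_density)
  with N(1) show ?thesis by (intro exI[of _ "density N (\<lambda>_. L 1)"]) simp
qed

end

section \<open>Preservers of sums of squares\<close>

lemma SOS_iff_nonneg: "f \<in> SOS \<longleftrightarrow> (\<forall>x. poly f x \<ge> 0)"
proof
  assume "f \<in> SOS"
  then show "\<forall>x. poly f x \<ge> 0"
    by (auto simp: SOS_def poly_sum intro!: sum_nonneg)
next
  assume "\<forall>x. poly f x \<ge> 0"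
  then obtain a b where ab: "f = a\<^sup>2 + b\<^sup>2"
    using nonneg_poly_eq_two_squares by blast
  define p where "p i = (if i = 1 then a else b)" for i :: nat
  have "f = (\<Sum>i=1..2. (p i)\<^sup>2)"
    by (simp add: ab p_def numeral_2_eq_2)
  then show "f \<in> SOS" unfolding SOS_def by (intro CollectI exI[of _ 2] exI[of _ p]) simp
qed

section \<open>Translations and Taylor coefficients\<close>

definition shift :: "real \<Rightarrow> real poly \<Rightarrow> real poly" where
  "shift h f = pcompose f [:h, 1:]"

lemma poly_shift: "poly (shift h f) x = poly f (h + x)"
  by (simp add: shift_def poly_pcompose)

lemma degree_shift [simp]: "degree (shift h f) = degree f"
  by (simp add: shift_def degree_pcompose)

lemma shift_shift_minus: "shift h (shift (- h) f) = f"
  by (simp add: poly_eq_poly_eq_iff[symmetric] fun_eq_iff poly_shift)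

lemma shift_0: "shift 0 f = f"
  by (simp add: poly_eq_poly_eq_iff[symmetric] fun_eq_iff poly_shift)

lemma shift_SOS: "f \<in> SOS \<Longrightarrow> shift h f \<in> SOS"
  by (simp add: SOS_iff_nonneg poly_shift)

lemma higher_pderiv_shift: "(pderiv ^^ i) (shift h f) = shift h ((pderiv ^^ i) f)"
proof -
  have "pderiv (shift h g) = shift h (pderiv g)" for g
    by (simp add: shift_def pderiv_pcompose pderiv_pCons)
  then show ?thesis by (induction i) simp_all
qed

text \<open>Taylor's formula: differentiation commutes with translation, so the derivative at
  \<open>h\<close> is that of the translate at 0.\<close>

lemma poly_higher_pderiv_eq_coeff_shift:
  "poly ((pderiv ^^ i) f) h = fact i * coeff (shift h f) i"
proof -
  have "poly ((pderiv ^^ i) f) h = poly ((pderiv ^^ i) (shift h f)) 0"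
    by (simp add: higher_pderiv_shift poly_shift)
  then show ?thesis
    by (simp add: poly_0_coeff_0 coeff_higher_pderiv pochhammer_fact)
qed

text \<open>The functional \<open>L\<^sub>y\<close> of the introductory remark.\<close>
definition symbol_functional :: "(nat \<Rightarrow> real poly) \<Rightarrow> real \<Rightarrow> real poly \<Rightarrow> real" where
  "symbol_functional q y f = (\<Sum>i\<le>degree f. fact i * poly (q i) y * coeff f i)"

lemma symbol_functional_altdef:
  assumes "degree f \<le> n"
  shows "symbol_functional q y f = (\<Sum>i\<le>n. fact i * poly (q i) y * coeff f i)"
  unfolding symbol_functional_def
  by (rule sum.mono_neutral_left) (use assms in \<open>auto simp: coeff_eq_0\<close>)

lemma symbol_functional_add:
  "symbol_functional q y (f + g) = symbol_functional q y f + symbol_functional q y g"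
proof -
  define n where "n = max (degree f) (degree g)"
  have "degree (f + g) \<le> n" "degree f \<le> n" "degree g \<le> n"
    by (auto simp: n_def intro: degree_add_le_max)
  then show ?thesis
    by (simp add: symbol_functional_altdef[of _ n] distrib_left sum.distrib)
qed

lemma symbol_functional_smult:
  "symbol_functional q y (smult c f) = c * symbol_functional q y f"
  using degree_smult_le[of c f]
  by (simp add: symbol_functional_altdef[of _ "degree f"] sum_distrib_left mult_ac)

lemma symbol_functional_monom: "symbol_functional q y (monom 1 i) = fact i * poly (q i) y"
  by (simp add: symbol_functional_altdef[of _ i] degree_monom_le if_distrib
      cong: if_cong)

lemma symbol_functional_sum:
  "symbol_functional q y (\<Sum>x\<in>A. f x) = (\<Sum>x\<in>A. symbol_functional q y (f x))"
  by (induction A rule: infinite_finite_induct)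
    (simp_all add: symbol_functional_add, simp_all add: symbol_functional_def)

lemma nonneg_on_SOS_iff_squares:
  "(\<forall>f\<in>SOS. symbol_functional q y f \<ge> 0) \<longleftrightarrow> (\<forall>p. symbol_functional q y (p\<^sup>2) \<ge> 0)"
proof
  assume "\<forall>p. symbol_functional q y (p\<^sup>2) \<ge> 0"
  then show "\<forall>f\<in>SOS. symbol_functional q y f \<ge> 0"
    by (auto simp: SOS_def symbol_functional_sum intro!: sum_nonneg)
qed (simp add: SOS_iff_nonneg)

lemma psd_functional_symbol_functional:
  assumes "\<forall>f\<in>SOS. symbol_functional q y f \<ge> 0"
  shows "psd_functional (symbol_functional q y)"
  using assms
  by unfold_locales (simp_all add: symbol_functional_add symbol_functional_smult
      nonneg_on_SOS_iff_squares)

text \<open>By Taylor expansion at \<open>y\<close>. The evaluation point enters twice, as the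
  parameter of the functional and as the translation.\<close>

lemma poly_diff_op:
  "poly (diff_op q f) y = symbol_functional q y (shift y f)"
  by (simp add: diff_op_def poly_sum poly_higher_pderiv_eq_coeff_shift symbol_functional_def
      mult_ac)

text \<open>Freezing the coefficients at \<open>y\<close> decouples the parameter \<open>y\<close>
  from the translation by \<open>x\<close>.\<close>

lemma poly_diff_op_at:
  "poly (diff_op_at q y f) x = symbol_functional q y (shift x f)"
  by (simp add: diff_op_at_def poly_diff_op) (simp add: symbol_functional_def)

lemma linear_diff_op: "diff_op q \<in> lin_ops"
proof -
  have "diff_op q (f + g) = diff_op q f + diff_op q g" for f g
    by (rule poly_ext) (simp add: poly_diff_op symbol_functional_add shift_def pcompose_add)
  moreover have "diff_op q (smult c f) = smult c (diff_op q f)" for c f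
    by (rule poly_ext) (simp add: poly_diff_op symbol_functional_smult shift_def pcompose_smult)
  moreover have "vector_space (smult :: real \<Rightarrow> real poly \<Rightarrow> real poly)"
    by unfold_locales (simp_all add: smult_add_left smult_add_right)
  ultimately show ?thesis
    by (simp add: lin_ops_def Vector_Spaces.linear_iff)
qed

text \<open>Translations map sums of squares to sums of squares, so applying \<open>T\<close> to the
  translate of \<open>f\<close> by \<open>-y\<close> and evaluating at \<open>y\<close> isolates the
  functional \<open>L\<^sub>y\<close> at \<open>f\<close>.\<close>

lemma diff_op_preserves_SOS_iff:
  assumes "T \<in> lin_ops" "\<forall>f. T f = diff_op q f"
  shows "T \<in> preservers SOS \<longleftrightarrow> (\<forall>y. \<forall>f\<in>SOS. symbol_functional q y f \<ge> 0)"
proof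
  assume T: "T \<in> preservers SOS"
  show "\<forall>y. \<forall>f\<in>SOS. symbol_functional q y f \<ge> 0"
  proof (intro allI ballI)
    fix y f assume "f \<in> SOS"
    then have "T (shift (- y) f) \<in> SOS"
      using T shift_SOS by (auto simp: preservers_def)
    then have "poly (T (shift (- y) f)) y \<ge> 0" by (simp add: SOS_iff_nonneg)
    then show "symbol_functional q y f \<ge> 0"
      by (simp add: assms(2) poly_diff_op shift_shift_minus)
  qed
next
  assume *: "\<forall>y. \<forall>f\<in>SOS. symbol_functional q y f \<ge> 0"
  have "poly (T f) y \<ge> 0" if "f \<in> SOS" for f y
    using * shift_SOS[OF that] by (simp add: assms(2) poly_diff_op)
  then have "T f \<in> SOS" if "f \<in> SOS" for f
    using that SOS_iff_nonneg[of "T f"] by blast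
  then show "T \<in> preservers SOS"
    using assms(1) by (auto simp: preservers_def)
qed

lemma diff_op_at_preserves_SOS_iff:
  "diff_op_at q y \<in> preservers SOS \<longleftrightarrow> (\<forall>f\<in>SOS. symbol_functional q y f \<ge> 0)"
proof
  assume T: "diff_op_at q y \<in> preservers SOS"
  show "\<forall>f\<in>SOS. symbol_functional q y f \<ge> 0"
  proof
    fix f assume "f \<in> SOS"
    then have "diff_op_at q y f \<in> SOS"
      using T by (auto simp: preservers_def)
    then have "poly (diff_op_at q y f) 0 \<ge> 0" by (simp add: SOS_iff_nonneg)
    then show "symbol_functional q y f \<ge> 0"
      by (simp add: poly_diff_op_at shift_0)
  qed
next
  assume "\<forall>f\<in>SOS. symbol_functional q y f \<ge> 0"
  then have "diff_op_at q y f \<in> SOS" if "f \<in> SOS" for f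
    using shift_SOS[OF that] unfolding SOS_iff_nonneg[of "diff_op_at q y f"] poly_diff_op_at
    by blast
  moreover have "diff_op_at q y \<in> lin_ops"
    unfolding diff_op_at_def by (rule linear_diff_op)
  ultimately show "diff_op_at q y \<in> preservers SOS"
    by (auto simp: preservers_def)
qed

text \<open>The weights \<open>k!\<close> of the Fischer-Fock product are the factorials in the
  moments of \<open>L\<^sub>y\<close>; truncating the symbol at \<open>m\<close> loses nothing on
  degree at most \<open>m\<close>.\<close>

lemma fischer_symbol_at:
  assumes "degree f \<le> m"
  shows "fischer (symbol_at q y m) f = symbol_functional q y f"
proof -
  have coeff: "coeff (symbol_at q y m) k = (if k \<le> m then poly (q k) y else 0)" for k
    by (simp add: symbol_at_def coeff_sum)
  show ?thesis
    unfolding fischer_def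
    by (subst symbol_functional_altdef[of f "max (degree (symbol_at q y m)) (degree f)"])
      (use assms in \<open>auto simp: coeff coeff_eq_0 intro!: sum.cong\<close>)
qed

lemma nonneg_on_SOS_iff_fischer:
  "(\<forall>f\<in>SOS. symbol_functional q y f \<ge> 0) \<longleftrightarrow>
     (\<forall>m. \<forall>f\<in>SOS_upto (2 * m). fischer (symbol_at q y (2 * m)) f \<ge> 0)"
proof
  assume "\<forall>f\<in>SOS. symbol_functional q y f \<ge> 0"
  then show "\<forall>m. \<forall>f\<in>SOS_upto (2 * m). fischer (symbol_at q y (2 * m)) f \<ge> 0"
    by (simp add: SOS_upto_def polys_upto_def fischer_symbol_at)
next
  assume *: "\<forall>m. \<forall>f\<in>SOS_upto (2 * m). fischer (symbol_at q y (2 * m)) f \<ge> 0"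
  show "\<forall>f\<in>SOS. symbol_functional q y f \<ge> 0"
  proof
    fix f assume "f \<in> SOS"
    \<comment> \<open>Twice the degree is an even bound on the degree of \<open>f\<close>, as the
      form of the condition asks.\<close>
    then have "f \<in> SOS_upto (2 * degree f)" by (simp add: SOS_upto_def polys_upto_def)
    with * have "fischer (symbol_at q y (2 * degree f)) f \<ge> 0" by blast
    then show "symbol_functional q y f \<ge> 0" by (simp add: fischer_symbol_at)
  qed
qed

text \<open>The entry at \<open>(i, j)\<close> is \<open>L\<^sub>y\<close> of the product of the
  monomials of degrees \<open>i\<close> and \<open>j\<close>, so the Hankel matrix is the Gram
  matrix of the monomials.\<close>

lemma hankel_quadratic_form:
  "scalar_prod (Matrix.vec (m + 1) c) (mult_mat_vec (hankel_at q y m) (Matrix.vec (m + 1) c)) =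
     symbol_functional q y ((\<Sum>i\<le>m. monom (c i) i)\<^sup>2)"
proof -
  have "(\<Sum>i\<le>m. monom (c i) i)\<^sup>2 = (\<Sum>i\<le>m. \<Sum>j\<le>m. smult (c i * c j) (monom 1 (i + j)))"
    by (simp add: power2_eq_square sum_product mult_monom smult_monom)
  then have "symbol_functional q y ((\<Sum>i\<le>m. monom (c i) i)\<^sup>2) =
      (\<Sum>i\<le>m. \<Sum>j\<le>m. c i * c j * (fact (i + j) * poly (q (i + j)) y))"
    by (simp add: symbol_functional_sum symbol_functional_smult symbol_functional_monom)
  also have "\<dots> = (\<Sum>i<m + 1. c i * (\<Sum>j<m + 1. fact (i + j) * poly (q (i + j)) y * c j))"
    by (simp add: lessThan_Suc_atMost sum_distrib_left mult_ac)
  also have "\<dots> = scalar_prod (Matrix.vec (m + 1) c) (mult_mat_vec (hankel_at q y m) (Matrix.vec (m + 1) c))"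
    by (simp add: scalar_prod_def hankel_at_def atLeast0LessThan row_def)
  finally show ?thesis by simp
qed

text \<open>Vectors of length \<open>m + 1\<close> are exactly the coefficient vectors of
  polynomials of degree at most \<open>m\<close>, and every polynomial occurs for some
  \<open>m\<close>.\<close>

lemma nonneg_on_SOS_iff_hankel:
  "(\<forall>f\<in>SOS. symbol_functional q y f \<ge> 0) \<longleftrightarrow> (\<forall>m. psd_mat (hankel_at q y m))"
proof -
  have sym: "square_mat (hankel_at q y m)" "transpose_mat (hankel_at q y m) = hankel_at q y m" for m
    by (auto simp: hankel_at_def add.commute intro!: eq_matI)
  have dim: "dim_row (hankel_at q y m) = m + 1" for m
    by (simp add: hankel_at_def)
  show ?thesis
    unfolding nonneg_on_SOS_iff_squares
  proof
    assume *: "\<forall>p. symbol_functional q y (p\<^sup>2) \<ge> 0"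
    have "scalar_prod x (mult_mat_vec (hankel_at q y m) x) \<ge> 0"
      if "x \<in> carrier_vec (m + 1)" for x m
    proof -
      have "x = Matrix.vec (m + 1) (\<lambda>i. vec_index x i)" using that by auto
      then show ?thesis using * hankel_quadratic_form[of m "vec_index x" q y] by simp
    qed
    then show "\<forall>m. psd_mat (hankel_at q y m)"
      using sym by (simp add: psd_mat_def dim)
  next
    assume *: "\<forall>m. psd_mat (hankel_at q y m)"
    show "\<forall>p. symbol_functional q y (p\<^sup>2) \<ge> 0"
    proof
      fix p :: "real poly"
      define m where "m = degree p"
      have "Matrix.vec (m + 1) (coeff p) \<in> carrier_vec (dim_row (hankel_at q y m))"
        by (simp add: dim)
      with * have "scalar_prod (Matrix.vec (m + 1) (coeff p))
          (mult_mat_vec (hankel_at q y m) (Matrix.vec (m + 1) (coeff p))) \<ge> 0"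
        unfolding psd_mat_def by blast
      then show "symbol_functional q y (p\<^sup>2) \<ge> 0"
        unfolding hankel_quadratic_form by (simp add: m_def poly_as_sum_of_monoms)
    qed
  qed
qed

lemma symbol_functional_eq_integral:
  assumes "moment_family q \<mu>"
  shows "symbol_functional q y f = (LINT t|\<mu> y. poly f t)"
proof -
  have sets: "sets (\<mu> y) = sets borel" and int: "integrable (\<mu> y) (\<lambda>t. \<bar>t ^ i\<bar>)"
    and mom: "fact i * poly (q i) y = (LINT t|\<mu> y. t ^ i)" for i
    using assms by (auto simp: moment_family_def moment_measures_def)
  have "(\<lambda>t. t ^ i :: real) \<in> borel_measurable (\<mu> y)" for i
    by (simp add: measurable_cong_sets[OF sets refl])
  then have int': "integrable (\<mu> y) (\<lambda>t. t ^ i)" for i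
    using int[of i] by (simp add: integrable_abs_iff)
  have "(LINT t|\<mu> y. poly f t) = (\<Sum>i\<le>degree f. coeff f i * (LINT t|\<mu> y. t ^ i))"
    using int' by (simp add: poly_altdef)
  then show ?thesis by (simp add: symbol_functional_def mom mult.commute)
qed

text \<open>Hamburger's theorem is applied for each \<open>y\<close> separately and a measure is
  chosen. The moments depend polynomially on \<open>y\<close> because they equal
  \<open>fact i * poly (q i) y\<close>. Conversely, integrals of nonnegative polynomials are
  nonnegative.\<close>

lemma nonneg_on_SOS_iff_moment_family:
  "(\<forall>y. \<forall>f\<in>SOS. symbol_functional q y f \<ge> 0) \<longleftrightarrow> (\<exists>\<mu>. moment_family q \<mu>)"
proof
  assume "\<forall>y. \<forall>f\<in>SOS. symbol_functional q y f \<ge> 0"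
  then have "\<exists>M. sets M = sets borel \<and> (\<forall>k. integrable M (\<lambda>t. t ^ k) \<and>
      (LINT t|M. t ^ k) = symbol_functional q y (monom 1 k))" for y
    using psd_functional.hamburger[OF psd_functional_symbol_functional] by blast
  then obtain \<mu> where \<mu>: "\<And>y. sets (\<mu> y) = sets borel"
      "\<And>y k. integrable (\<mu> y) (\<lambda>t. t ^ k)"
      "\<And>y k. (LINT t|\<mu> y. t ^ k) = fact k * poly (q k) y"
    unfolding symbol_functional_monom by metis
  have "\<exists>P. \<forall>s. (LINT t|\<mu> s. t ^ i) = poly P s" for i
    using \<mu>(3) by (intro exI[of _ "smult (fact i) (q i)"]) simp
  moreover have "\<mu> s \<in> moment_measures" for s
    using \<mu>(1,2) by (simp add: moment_measures_def integrable_abs)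
  ultimately have "moment_family q \<mu>"
    using \<mu>(3) by (simp add: moment_family_def)
  then show "\<exists>\<mu>. moment_family q \<mu>" by blast
next
  assume "\<exists>\<mu>. moment_family q \<mu>"
  then obtain \<mu> where "moment_family q \<mu>" by blast
  then show "\<forall>y. \<forall>f\<in>SOS. symbol_functional q y f \<ge> 0"
    by (simp add: symbol_functional_eq_integral SOS_iff_nonneg)
qed

theorem theorem2p1:
  fixes T :: "real poly \<Rightarrow> real poly" and q :: "nat \<Rightarrow> real poly"
  assumes "T \<in> lin_ops"
    and "\<forall>f. T f = diff_op q f"
  shows "(T \<in> preservers SOS \<longleftrightarrow> (\<forall>y. diff_op_at q y \<in> preservers SOS))
    \<and> (T \<in> preservers SOS \<longleftrightarrow>
         (\<forall>y m. \<forall>f \<in> SOS_upto (2 * m). fischer (symbol_at q y (2 * m)) f \<ge> 0))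
    \<and> (T \<in> preservers SOS \<longleftrightarrow>
         (\<forall>y m. symbol_at q y (2 * m) \<in> dual_cone (SOS_upto (2 * m))))
    \<and> (T \<in> preservers SOS \<longleftrightarrow> (\<forall>y m. psd_mat (hankel_at q y m)))
    \<and> (T \<in> preservers SOS \<longleftrightarrow> (\<exists>\<mu>. moment_family q \<mu>))
    \<and> (\<forall>\<mu>. moment_family q \<mu> \<longrightarrow>
         (\<forall>y f x. poly (diff_op_at q y f) x = (LINT t|\<mu> y. poly f (t + x))))"
proof -
  note T = diff_op_preserves_SOS_iff[OF assms]
  have fischer: "T \<in> preservers SOS \<longleftrightarrow>
      (\<forall>y m. \<forall>f \<in> SOS_upto (2 * m). fischer (symbol_at q y (2 * m)) f \<ge> 0)"
    unfolding T nonneg_on_SOS_iff_fischer ..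
  have "poly (diff_op_at q y f) x = (LINT t|\<mu> y. poly f (t + x))" if "moment_family q \<mu>" for \<mu> y f x
    by (simp add: poly_diff_op_at symbol_functional_eq_integral[OF that] poly_shift add.commute)
  moreover have "T \<in> preservers SOS \<longleftrightarrow> (\<forall>y m. psd_mat (hankel_at q y m))"
    unfolding T nonneg_on_SOS_iff_hankel ..
  ultimately show ?thesis
    using fischer T nonneg_on_SOS_iff_moment_family[of q]
    by (auto simp: diff_op_at_preserves_SOS_iff dual_cone_def)
qed

end
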